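(* Let $q$ be a prime power, let $n,k,\ell$ be positive integers with $k<n$, and suppose $r:=n-k\ge 2$. Let $\mathcal{C}$ be an $(n,k,\ell)$ MDS array code over $\mathbb{F}_q$. Then each of the four quantities $\beta_{\mathrm{avg}}(\mathcal{C})$, $\beta_{\max}(\mathcal{C})$, $\gamma_{\mathrm{avg}}(\mathcal{C})$, $\gamma_{\max}(\mathcal{C})$ (average and worst-case repair bandwidth, average and worst-case repair I/O, under linear exact repair) is at least $$\ell(n-1)-\frac{q^{(r-1)\ell}-1}{q-1}.$$
   Context: Write $[n]=\{1,\dots,n\}$. An $(n,k,\ell)$ linear array code over $\mathbb{F}_q$ is an $\mathbb{F}_q$-subspace $\mathcal{C}\le(\mathbb{F}_q^\ell)^n$ of dimension $k\ell$; here $1\le k<n$ and $r:=n-k$. It is described by a block parity-check matrix $H=[H_1\ H_2\ \cdots\ H_n]\in\mathbb{F}_q^{r\ell\times n\ell}$ of full row rank $r\ell$, with $H_i\in\mathbb{F}_q^{r\ell\times\ell}$, so that $\mathcal{C}=\{(C_1,\dots,C_n)\in(\mathbb{F}_q^\ell)^n:\sum_{i=1}^n H_iC_i=0\}$. The code is MDS if for every $I\subseteq[n]$ with $|I|=r$ the square matrix $[H_i]_{i\in I}\in\mathbb{F}_q^{r\ell\times r\ell}$ is invertible. For $i\in[n]$ let $\mathcal{M}_i=\{M\in\mathbb{F}_q^{\ell\times r\ell}: MH_i\text{ is invertible}\}$ (the linear repair matrices for node $i$). For $M\in\mathcal{M}_i$ put $\mathrm{BW}_i(M)=\sum_{j\ne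 i}\mathrm{rank}(MH_j)$ and $\mathrm{IO}_i(M)=\sum_{j\ne i}\mathrm{nz}(MH_j)$, where $\mathrm{nz}(A)$ is the number of nonzero columns of $A$. Define $\beta_i(\mathcal{C})=\min_{M\in\mathcal{M}_i}\mathrm{BW}_i(M)$, $\gamma_i(\mathcal{C})=\min_{M\in\mathcal{M}_i}\mathrm{IO}_i(M)$, and $\beta_{\mathrm{avg}}(\mathcal{C})=\frac1n\sum_{i=1}^n\beta_i(\mathcal{C})$, $\beta_{\max}(\mathcal{C})=\max_{i\in[n]}\beta_i(\mathcal{C})$, $\gamma_{\mathrm{avg}}(\mathcal{C})=\frac1n\sum_{i=1}^n\gamma_i(\mathcal{C})$, $\gamma_{\max}(\mathcal{C})=\max_{i\in[n]}\gamma_i(\mathcal{C})$. (These do not depend on the choice of $H$, since $H$ is determined by $\mathcal{C}$ up to left multiplication by an invertible matrix.) *)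

theory Defs
  imports
    Complex_Main
    "HOL-Library.Cardinality"
    "Jordan_Normal_Form.Matrix_Kernel"
    "Jordan_Normal_Form.DL_Rank"
    "Jordan_Normal_Form.DL_Submatrix"
begin

text \<open>
  The finite field with \<open>q\<close> elements is a type \<open>'a\<close> of sort \<open>{field, finite}\<close> with
  \<open>CARD('a) = q\<close>. Nodes are numbered \<open>0, \<dots>, n - 1\<close>. An element \<open>(C\<^sub>0, \<dots>, C\<^sub>n\<^sub>-\<^sub>1)\<close> of
  \<open>(F\<^sub>q\<^sup>l)\<^sup>n\<close> is stored as the concatenated vector of length \<open>n * l\<close>, so entry \<open>b\<close> of block \<open>i\<close>
  is at position \<open>i * l + b\<close>; a block parity-check matrix is an ordinary matrix
  with \<open>n * l\<close> columns, whose column \<open>c\<close> belongs to node \<open>c div l\<close>.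
\<close>

definition linear_array_code :: "nat \<Rightarrow> nat \<Rightarrow> nat \<Rightarrow> 'a::field vec set \<Rightarrow> bool" where
  "linear_array_code n k l C \<longleftrightarrow>
     VectorSpace.subspace class_ring C (module_vec TYPE('a) (n * l)) \<and>
     vectorspace.dim class_ring ((module_vec TYPE('a) (n * l))\<lparr>carrier := C\<rparr>) = k * l"

text \<open>
  For \<open>H = [H\<^sub>0 \<dots> H\<^sub>n\<^sub>-\<^sub>1]\<close> and a concatenated vector \<open>c\<close> with blocks \<open>C\<^sub>i\<close>, the product \<open>H *\<^sub>v c\<close> is
  \<open>\<Sum>i<n. H\<^sub>i *\<^sub>v C\<^sub>i\<close>, so the code described by \<open>H\<close> is its kernel.
\<close>

definition parity_check :: "nat \<Rightarrow> nat \<Rightarrow> nat \<Rightarrow> 'a::field vec set \<Rightarrow> 'a mat \<Rightarrow> bool" where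
  "parity_check n k l C H \<longleftrightarrow>
     H \<in> carrier_mat ((n - k) * l) (n * l) \<and>
     vec_space.rank ((n - k) * l) H = (n - k) * l \<and>
     C = mat_kernel H"

definition block :: "nat \<Rightarrow> 'a mat \<Rightarrow> nat \<Rightarrow> 'a mat" where
  "block l H i = mat (dim_row H) l (\<lambda>(a, b). H $$ (a, i * l + b))"

text \<open>The matrix \<open>[H\<^sub>i]\<^sub>i\<^sub>\<in>\<^sub>I\<close>, with the blocks in increasing order of \<open>i\<close>:\<close>

definition blocks :: "nat \<Rightarrow> 'a mat \<Rightarrow> nat set \<Rightarrow> 'a mat" where
  "blocks l H I = submatrix H UNIV {c. c div l \<in> I}"

definition mds :: "nat \<Rightarrow> nat \<Rightarrow> nat \<Rightarrow> 'a::field mat \<Rightarrow> bool" where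
  "mds n k l H \<longleftrightarrow> (\<forall>I \<subseteq> {..<n}. card I = n - k \<longrightarrow> invertible_mat (blocks l H I))"

definition repair_matrices :: "nat \<Rightarrow> 'a::field mat \<Rightarrow> nat \<Rightarrow> 'a mat set" where
  "repair_matrices l H i = {M \<in> carrier_mat l (dim_row H). invertible_mat (M * block l H i)}"

definition nz :: "'a::zero mat \<Rightarrow> nat" where
  "nz A = card {c. c < dim_col A \<and> col A c \<noteq> 0\<^sub>v (dim_row A)}"

definition BW :: "nat \<Rightarrow> nat \<Rightarrow> 'a::field mat \<Rightarrow> nat \<Rightarrow> 'a mat \<Rightarrow> nat" where
  "BW n l H i M = (\<Sum>j \<in> {..<n} - {i}. vec_space.rank l (M * block l H j))"

definition IO :: "nat \<Rightarrow> nat \<Rightarrow> 'a::field mat \<Rightarrow> nat \<Rightarrow> 'a mat \<Rightarrow> nat" where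
  "IO n l H i M = (\<Sum>j \<in> {..<n} - {i}. nz (M * block l H j))"

text \<open>
  The quantities below are written as functions of a parity-check matrix \<open>H\<close> of the code,
  and statements about a code range over all its parity-check matrices. Over a finite
  field the minima range over finite sets, which the MDS property makes nonempty.
\<close>

definition beta :: "nat \<Rightarrow> nat \<Rightarrow> 'a::field mat \<Rightarrow> nat \<Rightarrow> nat" where
  "beta n l H i = Min (BW n l H i ` repair_matrices l H i)"

definition gamma :: "nat \<Rightarrow> nat \<Rightarrow> 'a::field mat \<Rightarrow> nat \<Rightarrow> nat" where
  "gamma n l H i = Min (IO n l H i ` repair_matrices l H i)"

definition beta_avg :: "nat \<Rightarrow> nat \<Rightarrow> 'a::field mat \<Rightarrow> real" where
  "beta_avg n l H = (\<Sum>i<n. real (beta n l H i)) / real n"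

definition beta_max :: "nat \<Rightarrow> nat \<Rightarrow> 'a::field mat \<Rightarrow> nat" where
  "beta_max n l H = Max (beta n l H ` {..<n})"

definition gamma_avg :: "nat \<Rightarrow> nat \<Rightarrow> 'a::field mat \<Rightarrow> real" where
  "gamma_avg n l H = (\<Sum>i<n. real (gamma n l H i)) / real n"

definition gamma_max :: "nat \<Rightarrow> nat \<Rightarrow> 'a::field mat \<Rightarrow> nat" where
  "gamma_max n l H = Max (gamma n l H ` {..<n})"

end

theory Submission
  imports Defs "Berlekamp_Zassenhaus.Berlekamp_Type_Based"
begin

text \<open>
  Let \<open>M\<close> repair node \<open>i\<close> and let \<open>K\<close> be the kernel of \<open>M\<close>. Since \<open>M H\<^sub>i\<close> is invertible, \<open>M\<close> is onto and
  \<open>K\<close> has \<open>q\<^bsup>(r-1)l\<^esup>\<close> elements. For \<open>j \<noteq> i\<close> the matrix \<open>H\<^sub>j\<close> maps the kernel of \<open>M H\<^sub>j\<close>, of dimension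
  \<open>d\<^sub>j = l - rank (M H\<^sub>j)\<close>, injectively into \<open>K\<close>. As \<open>r \<ge> 2\<close>, the MDS property makes the column
  spaces of distinct blocks meet only in \<open>0\<close>, so counting nonzero vectors gives
  \<open>\<Sum>\<^sub>j (q\<^bsup>d\<^sub>j\<^esup> - 1) \<le> q\<^bsup>(r-1)l\<^esup> - 1\<close>. Bernoulli's inequality \<open>(q - 1) d \<le> q\<^bsup>d\<^esup> - 1\<close> then bounds
  \<open>\<Sum>\<^sub>j d\<^sub>j\<close>, and hence the repair bandwidth. The repair I/O is at least the bandwidth because a rank is
  at most the number of nonzero columns.
\<close>

section \<open>Ranks and the sizes of images and kernels\<close>

lemma block_carrier: "block l H i \<in> carrier_mat (dim_row H) l"
  by (simp add: block_def)

text \<open>Provides the set whose cardinality \<open>rank_card_indpt\<close> identifies with the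
  rank.\<close>

lemma (in vec_space) maximal_indpt_cols:
  "\<exists>S. maximal S (\<lambda>T. T \<subseteq> set (cols A) \<and> lin_indpt T)"
  using maximal_exists_superset[of "set (cols A)" "\<lambda>T. T \<subseteq> set (cols A) \<and> lin_indpt T" "{}"]
    finite_lin_indpt2[of "{}"] by auto

text \<open>A maximal independent set of columns omits the zero vector, so its members arise from
  nonzero columns at distinct indices.\<close>

lemma rank_le_nz:
  fixes A :: "'a::field mat"
  assumes A: "A \<in> carrier_mat m p"
  shows "vec_space.rank m A \<le> nz A"
proof -
  interpret vec_space "TYPE('a)" m .
  obtain S where S: "maximal S (\<lambda>T. T \<subseteq> set (cols A) \<and> lin_indpt T)"
    using maximal_indpt_cols by blast
  then have sub: "S \<subseteq> set (cols A)" and li: "lin_indpt S"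
    by (auto simp: maximal_def)
  have "S \<subseteq> carrier_vec m" using sub cols_dim A by blast
  moreover have "(UNIV :: 'a set) \<noteq> {0}"
    by (metis UNIV_I singletonD zero_neq_one)
  ultimately have "0\<^sub>v m \<notin> S" using zero_nin_lin_indpt[OF _ li] by simp
  then have "S \<subseteq> col A ` {c. c < dim_col A \<and> col A c \<noteq> 0\<^sub>v (dim_row A)}"
  proof (intro subsetI)
    fix v assume v: "v \<in> S"
    with sub obtain c where c: "c < dim_col A" "v = col A c" by (auto simp: cols_def)
    moreover have "v \<noteq> 0\<^sub>v (dim_row A)"
      using v \<open>0\<^sub>v m \<notin> S\<close> carrier_matD(1)[OF A] by auto
    ultimately show "v \<in> col A ` {c. c < dim_col A \<and> col A c \<noteq> 0\<^sub>v (dim_row A)}"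
      by blast
  qed
  then have "card S \<le> nz A"
    unfolding nz_def by (rule surj_card_le[rotated]) simp
  then show ?thesis using rank_card_indpt[OF A S] by simp
qed

text \<open>The image is the column space, hence lies in the span of a maximal independent set
  \<open>S\<close> of columns. A vector there is given by its coefficients on \<open>S\<close>, and
  \<open>card S\<close> is the rank.\<close>

lemma card_image_le_rank:
  fixes A :: "'a::{field,finite} mat"
  assumes A: "A \<in> carrier_mat m p"
  shows "card ((*\<^sub>v) A ` carrier_vec p) \<le> CARD('a) ^ vec_space.rank m A"
proof -
  interpret vec_space "TYPE('a)" m .
  obtain S where S: "maximal S (\<lambda>T. T \<subseteq> set (cols A) \<and> lin_indpt T)"
    using maximal_indpt_cols by blast
  then have sub: "S \<subseteq> set (cols A)" and li: "lin_indpt S"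
    by (auto simp: maximal_def)
  have car: "set (cols A) \<subseteq> carrier_vec m" using cols_dim A by blast
  have fin: "finite S" using sub finite_subset by blast
  have SC: "S \<subseteq> carrier_vec m" using sub car by blast
  have cols: "set (cols A) \<subseteq> span S"
  proof
    fix s assume s: "s \<in> set (cols A)"
    show "s \<in> span S"
    proof (rule ccontr)
      assume ns: "s \<notin> span S"
      then have "lin_indpt (S \<union> {s})"
        using lin_dep_iff_in_span[OF SC li, of s] s car in_own_span[OF SC] by blast
      with S s sub have "s \<in> S" unfolding maximal_def by blast
      with ns in_own_span[OF SC] show False by blast
    qed
  qed
  have "(*\<^sub>v) A ` carrier_vec p \<subseteq> span (set (cols A))"
    using col_space_eq[OF A] A unfolding col_space_def by auto
  also have "\<dots> \<subseteq> span S" using cols span_is_subset span_is_submodule[OF SC] by auto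
  \<comment> \<open>Restricting the coefficients to \<open>S\<close> makes the functions
    extensional, so that there are only \<open>CARD('a) ^ card S\<close> of them.\<close>
  also have "\<dots> \<subseteq> (\<lambda>a. lincomb a S) ` (S \<rightarrow>\<^sub>E UNIV)"
  proof
    fix v assume "v \<in> span S"
    then obtain a where "lincomb a S = v" using finite_in_span[OF fin, of v] SC by auto
    then have "v = lincomb (restrict a S) S" using SC by (auto intro!: lincomb_cong)
    then show "v \<in> (\<lambda>a. lincomb a S) ` (S \<rightarrow>\<^sub>E UNIV)"
      using image_eqI[of v "\<lambda>a. lincomb a S" "restrict a S" "S \<rightarrow>\<^sub>E UNIV"] by simp
  qed
  finally have "card ((*\<^sub>v) A ` carrier_vec p) \<le> card (S \<rightarrow>\<^sub>E (UNIV :: 'a set))"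
    by (rule surj_card_le[rotated]) (simp add: fin finite_PiE)
  also have "\<dots> = CARD('a) ^ rank A"
    by (simp add: card_funcsetE fin rank_card_indpt[OF A S])
  finally show ?thesis .
qed

lemma zero_in_mat_kernel: "A \<in> carrier_mat m p \<Longrightarrow> 0\<^sub>v p \<in> mat_kernel (A :: 'a::field mat)"
  by (auto simp: mat_kernel_def intro!: eq_vecI)

text \<open>Rank-nullity by counting: a vector \<open>x\<close> is determined by its image
  \<open>A *\<^sub>v x\<close> and the kernel vector \<open>x - s (A *\<^sub>v x)\<close>.\<close>

lemma card_kernel_ge:
  fixes A :: "'a::{field,finite} mat"
  assumes A: "A \<in> carrier_mat m p"
  shows "CARD('a) ^ (p - vec_space.rank m A) \<le> card (mat_kernel A)"
proof -
  interpret vec_space "TYPE('a)" m .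
  let ?q = "CARD('a)" and ?I = "(*\<^sub>v) A ` carrier_vec p"
  \<comment> \<open>\<open>s\<close> chooses an arbitrary preimage of each point of the image,
    without regard to linearity.\<close>
  define s where "s = inv_into (carrier_vec p) ((*\<^sub>v) A)"
  have s: "s y \<in> carrier_vec p" "A *\<^sub>v s y = y" if "y \<in> ?I" for y
    using that unfolding s_def by (auto simp: inv_into_into f_inv_into_f)
  have "inj_on (\<lambda>x. (A *\<^sub>v x, x - s (A *\<^sub>v x))) (carrier_vec p)"
  proof (rule inj_onI)
    fix x y assume x: "x \<in> carrier_vec p" and y: "y \<in> carrier_vec p"
      and eq: "(A *\<^sub>v x, x - s (A *\<^sub>v x)) = (A *\<^sub>v y, y - s (A *\<^sub>v y))"
    define z where "z = s (A *\<^sub>v x)"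
    have "z \<in> carrier_vec p" "x - z = y - z" using eq s(1)[of "A *\<^sub>v x", OF imageI, OF x] by (auto simp: z_def)
    then have "x - z + z = y - z + z" by simp
    moreover have "v - z + z = v" if "v \<in> carrier_vec p" for v
      using that \<open>z \<in> carrier_vec p\<close> by (intro eq_vecI) auto
    ultimately show "x = y" using x y by simp
  qed
  moreover have "(\<lambda>x. (A *\<^sub>v x, x - s (A *\<^sub>v x))) ` carrier_vec p \<subseteq> ?I \<times> mat_kernel A"
  proof clarify
    fix x :: "'a vec" assume x: "x \<in> carrier_vec p"
    have "A *\<^sub>v (x - s (A *\<^sub>v x)) = A *\<^sub>v x - A *\<^sub>v s (A *\<^sub>v x)"
      using A x s(1) by (intro mult_minus_distrib_mat_vec) auto
    also have "\<dots> = 0\<^sub>v m" using A x s(2)[of "A *\<^sub>v x"] by auto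
    finally show "A *\<^sub>v x \<in> ?I \<and> x - s (A *\<^sub>v x) \<in> mat_kernel A"
      using A x s(1) by (auto simp: mat_kernel_def)
  qed
  moreover have fin: "finite (?I \<times> mat_kernel A)" by (simp add: mat_kernel_def)
  ultimately have "card (carrier_vec p :: 'a vec set) \<le> card (?I \<times> mat_kernel A)"
    by (intro card_inj_on_le)
  also have "\<dots> \<le> ?q ^ rank A * card (mat_kernel A)"
    by (simp add: card_cartesian_product card_image_le_rank[OF A])
  also have "card (carrier_vec p :: 'a vec set) = ?q ^ rank A * ?q ^ (p - rank A)"
    using rank_le_nc[OF A] by (simp add: card_carrier_vec power_add[symmetric])
  finally show ?thesis by simp
qed

text \<open>The map from \<open>(x, y)\<close> to \<open>x + Y *\<^sub>v y\<close> is injective on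
  pairs with \<open>x\<close> in the kernel: applying \<open>M\<close> recovers \<open>y\<close>,
  and subtraction then recovers \<open>x\<close>.\<close>

lemma card_kernel_le_right_inverse:
  fixes M :: "'a::{field,finite} mat"
  assumes M: "M \<in> carrier_mat m p" and Y: "Y \<in> carrier_mat p m" and MY: "M * Y = 1\<^sub>m m"
  shows "card (mat_kernel M) * CARD('a) ^ m \<le> CARD('a) ^ p"
proof -
  have M_sum: "M *\<^sub>v (x + Y *\<^sub>v y) = y" if "x \<in> mat_kernel M" "y \<in> carrier_vec m" for x y
  proof -
    have x: "x \<in> carrier_vec p" "M *\<^sub>v x = 0\<^sub>v m" using that M by (auto simp: mat_kernel_def)
    have "M *\<^sub>v (x + Y *\<^sub>v y) = M *\<^sub>v x + M *\<^sub>v (Y *\<^sub>v y)"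
      using x Y that M by (intro mult_add_distrib_mat_vec) auto
    also have "M *\<^sub>v (Y *\<^sub>v y) = y"
      using assoc_mult_mat_vec[OF M Y that(2)] MY that by simp
    finally show ?thesis using x that by simp
  qed
  have "inj_on (\<lambda>(x, y). x + Y *\<^sub>v y) (mat_kernel M \<times> carrier_vec m)"
  proof (rule inj_onI, clarify)
    fix x y x' y' assume x: "x \<in> mat_kernel M" and x': "x' \<in> mat_kernel M"
      and y: "y \<in> carrier_vec m" and y': "y' \<in> carrier_vec m"
      and eq: "x + Y *\<^sub>v y = x' + Y *\<^sub>v y'"
    have "y = y'" using M_sum[OF x y] M_sum[OF x' y'] eq by simp
    moreover have "x \<in> carrier_vec p" "x' \<in> carrier_vec p" and "Y *\<^sub>v y \<in> carrier_vec p"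
      using x x' y Y M by (auto simp: mat_kernel_def)
    moreover have "u + w - w = u" if "u \<in> carrier_vec p" "w \<in> carrier_vec p" for u w :: "'a vec"
      using that by (intro eq_vecI) auto
    ultimately show "x = x' \<and> y = y'" using eq by metis
  qed
  moreover have "(\<lambda>(x, y). x + Y *\<^sub>v y) ` (mat_kernel M \<times> carrier_vec m) \<subseteq> carrier_vec p"
    using M Y by (auto simp: mat_kernel_def)
  ultimately have "card (mat_kernel M \<times> (carrier_vec m :: 'a vec set)) \<le> card (carrier_vec p :: 'a vec set)"
    by (intro card_inj_on_le) auto
  then show ?thesis by (simp add: card_cartesian_product card_carrier_vec)
qed

section \<open>Separation of two blocks by the MDS property\<close>

text \<open>\<open>X\<close> certifies that \<open>block l H i\<close> is injective and that its
  column space meets that of \<open>block l H j\<close> only in zero. It exists because both blocks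
  sit inside one invertible matrix.\<close>

lemma mds_separating_left_inverse:
  fixes H :: "'a::field mat"
  assumes mds: "mds n k l H" and H: "H \<in> carrier_mat ((n - k) * l) (n * l)"
    and ij: "i < n" "j < n" "i \<noteq> j" and r: "2 \<le> n - k"
  obtains X where "X \<in> carrier_mat l ((n - k) * l)"
    and "X * block l H i = 1\<^sub>m l" and "X * block l H j = 0\<^sub>m l l"
proof -
  let ?m = "(n - k) * l"
  \<comment> \<open>Here \<open>2 \<le> n - k\<close> enters: a set of \<open>n - k\<close> nodes
    has room for both \<open>i\<close> and \<open>j\<close>.\<close>
  obtain I where I: "{i, j} \<subseteq> I" "I \<subseteq> {..<n}" "card I = n - k"
    using exists_subset_between[of "{i, j}" "n - k" "{..<n}"] ij r by auto
  define J where "J = {c. c div l \<in> I}"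
  define B where "B = blocks l H I"
  \<comment> \<open>Since \<open>blocks\<close> keeps the columns in increasing order, column
    \<open>c\<close> of \<open>H\<close> lands at position \<open>pos c\<close> of
    \<open>B\<close>.\<close>
  define pos where "pos c = card {a \<in> J. a < c}" for c
  have "invertible_mat B" using mds I unfolding mds_def B_def by blast
  then obtain D where "square_mat B" and "inverts_mat B D" "inverts_mat D B"
    unfolding invertible_mat_def by blast
  moreover have "dim_row B = ?m"
    using H by (simp add: B_def blocks_def dim_submatrix)
  ultimately have B: "B \<in> carrier_mat ?m ?m" and BD: "B * D = 1\<^sub>m ?m"
    and DB': "D * B = 1\<^sub>m (dim_row D)"
    by (auto simp: inverts_mat_def)
  \<comment> \<open>\<open>inverts_mat\<close> does not state the format of \<open>D\<close>;
    comparing column counts in the two identities yields it.\<close>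
  have D: "D \<in> carrier_mat ?m ?m"
    using arg_cong[OF BD, of dim_col] arg_cong[OF DB', of dim_col] B by auto
  have DB: "D * B = 1\<^sub>m ?m" using DB' D by simp
  have B_entry: "B $$ (a, pos c) = H $$ (a, c)" if "a < ?m" "c < n * l" "c \<in> J" for a c
    using submatrix_index_card[of a H c UNIV J] H that
    by (simp add: B_def blocks_def J_def pos_def)
  have pos_less: "pos c < ?m" if "c < n * l" "c \<in> J" for c
  proof -
    have "pos c < card {c. c < dim_col H \<and> c \<in> J}"
      unfolding pos_def using that H by (intro psubset_card_mono) auto
    also have "\<dots> = dim_col B" by (simp add: B_def blocks_def dim_submatrix J_def)
    finally show ?thesis using B by simp
  qed
  \<comment> \<open>\<open>pick J\<close> undoes \<open>pos\<close> on \<open>J\<close>.\<close>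
  have pos_eq: "pos c = pos c' \<longleftrightarrow> c = c'" if "c \<in> J" "c' \<in> J" for c c'
    using pick_card_in_set[OF that(1)] pick_card_in_set[OF that(2)] unfolding pos_def by metis
  have index: "e * l + b < n * l \<and> e * l + b \<in> J" if "e \<in> I" "b < l" for e b
  proof -
    have "e * l + b < Suc e * l" using that by simp
    also have "\<dots> \<le> n * l" using that I by (intro mult_right_mono) auto
    finally show ?thesis using that by (simp add: J_def)
  qed
  \<comment> \<open>\<open>D\<close> is the inverse of \<open>[H\<^sub>e]\<^sub>e\<^sub>\<in>\<^sub>I\<close>; its rows at the positions of block \<open>i\<close> form \<open>X\<close>.\<close>
  define X where "X = mat l ?m (\<lambda>(a, c). D $$ (pos (i * l + a), c))"
  have X_entry: "(X * block l H e) $$ (a, b) = (if i = e \<and> a = b then 1 else 0)"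
    if e: "e \<in> I" and a: "a < l" and b: "b < l" for e a b
  proof -
    let ?c = "i * l + a" and ?d = "e * l + b"
    have cd: "?c < n * l" "?c \<in> J" "?d < n * l" "?d \<in> J" using index I e a b by auto
    have "(X * block l H e) $$ (a, b) = (\<Sum>x<?m. D $$ (pos ?c, x) * H $$ (x, ?d))"
      using a b H by (simp add: X_def block_def scalar_prod_def lessThan_atLeast0)
    also have "\<dots> = (\<Sum>x<?m. D $$ (pos ?c, x) * B $$ (x, pos ?d))"
      using B_entry cd by (intro sum.cong) auto
    also have "\<dots> = (D * B) $$ (pos ?c, pos ?d)"
      using B D pos_less cd by (simp add: scalar_prod_def lessThan_atLeast0)
    also have "\<dots> = (if ?c = ?d then 1 else 0)"
      using DB pos_less cd pos_eq by simp
    also have "?c = ?d \<longleftrightarrow> i = e \<and> a = b"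
    proof
      assume "?c = ?d"
      then have "?c div l = ?d div l" "?c mod l = ?d mod l" by auto
      then show "i = e \<and> a = b" using a b by simp
    qed simp
    finally show ?thesis .
  qed
  show ?thesis
  proof
    show "X \<in> carrier_mat l ?m" by (simp add: X_def)
    have "dim_row X = l" by (simp add: X_def)
    then show "X * block l H i = 1\<^sub>m l" "X * block l H j = 0\<^sub>m l l"
      using X_entry I ij by (auto intro!: eq_matI simp: block_def simp del: index_mult_mat(1))
  qed
qed

section \<open>Counting kernel vectors across the nodes\<close>

lemma exists_other_node:
  assumes "2 \<le> n - (k :: nat)"
  shows "\<exists>j<n. j \<noteq> (i :: nat)"
  using assms by (intro exI[of _ "if i = 0 then 1 else 0"]) auto

text \<open>Each \<open>V j\<close> is a copy of the nonzero kernel vectors of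
  \<open>M * block l H j\<close> among the nonzero vectors of the kernel of \<open>M\<close>, and
  these copies are pairwise disjoint.\<close>

lemma sum_kernel_card_le:
  fixes H :: "'a::{field,finite} mat"
  assumes mds: "mds n k l H" and H: "H \<in> carrier_mat ((n - k) * l) (n * l)"
    and r: "2 \<le> n - k" and M: "M \<in> carrier_mat l ((n - k) * l)" and J: "J \<subseteq> {..<n}"
  shows "(\<Sum>j\<in>J. card (mat_kernel (M * block l H j)) - 1) \<le> card (mat_kernel M) - 1"
proof -
  let ?m = "(n - k) * l"
  have Hb: "block l H j \<in> carrier_mat ?m l" for j using block_carrier[of l H j] H by simp
  define N where "N j = mat_kernel (M * block l H j) - {0\<^sub>v l}" for j
  define V where "V j = (*\<^sub>v) (block l H j) ` N j" for j
  have fin: "finite (mat_kernel A)" for A :: "'a mat" by (simp add: mat_kernel_def)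
  have NC: "x \<in> carrier_vec l" "x \<noteq> 0\<^sub>v l" "M *\<^sub>v (block l H j *\<^sub>v x) = 0\<^sub>v l" if "x \<in> N j" for x j
    using that M Hb[of j] assoc_mult_mat_vec[OF M Hb] by (auto simp: N_def mat_kernel_def)
  \<comment> \<open>Multiplying the equation by the separating \<open>X\<close> turns its left side
    into \<open>x\<close> and its right side into zero.\<close>
  have sep: "x = 0\<^sub>v l" if ij: "i < n" "j < n" "i \<noteq> j" and x: "x \<in> carrier_vec l" and y: "y \<in> carrier_vec l"
    and eq: "block l H i *\<^sub>v x = block l H j *\<^sub>v y" for i j x y
  proof -
    obtain X where X: "X \<in> carrier_mat l ?m" "X * block l H i = 1\<^sub>m l" "X * block l H j = 0\<^sub>m l l"
      using mds_separating_left_inverse[OF mds H ij r] by blast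
    have "x = X *\<^sub>v (block l H i *\<^sub>v x)"
      using assoc_mult_mat_vec[OF X(1) Hb x, of i] X x by simp
    also have "\<dots> = X *\<^sub>v (block l H j *\<^sub>v y)" using eq by simp
    also have "\<dots> = 0\<^sub>m l l *\<^sub>v y"
      using assoc_mult_mat_vec[OF X(1) Hb y, of j] X by simp
    also have "\<dots> = 0\<^sub>v l" using y by (intro eq_vecI) auto
    finally show ?thesis .
  qed
  have inj: "inj_on ((*\<^sub>v) (block l H j)) (N j)" if j: "j < n" for j
  proof -
    \<comment> \<open>The second node serves to invoke \<open>mds_separating_left_inverse\<close>,
      whose \<open>X\<close> is a left inverse of \<open>block l H j\<close>.\<close>
    obtain i where i: "i < n" "i \<noteq> j" 
      using exists_other_node[OF r, of j] by blast
    obtain X where X: "X \<in> carrier_mat l ?m" "X * block l H j = 1\<^sub>m l"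
      using mds_separating_left_inverse[OF mds H j i(1) _ r] i by blast
    show ?thesis
    proof (rule inj_on_inverseI)
      fix x assume "x \<in> N j"
      then show "X *\<^sub>v (block l H j *\<^sub>v x) = x"
        using assoc_mult_mat_vec[OF X(1) Hb, of x j] X NC(1) by simp
    qed
  qed
  have VK: "V j \<subseteq> mat_kernel M - {0\<^sub>v ?m}" if j: "j < n" for j
  proof -
    obtain i where i: "i < n" "i \<noteq> j" 
      using exists_other_node[OF r, of j] by blast
    have "block l H j *\<^sub>v x \<noteq> 0\<^sub>v ?m" if x: "x \<in> N j" for x
    proof
      assume "block l H j *\<^sub>v x = 0\<^sub>v ?m"
      \<comment> \<open>Zero is rewritten as a vector from another block, so that \<open>sep\<close>
        applies with the zero vector as \<open>y\<close>.\<close>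
      then have "block l H j *\<^sub>v x = block l H i *\<^sub>v 0\<^sub>v l"
        using Hb[of i] by (auto intro!: eq_vecI)
      then show False using sep[of j i x "0\<^sub>v l"] NC[OF x] i j by auto
    qed
    then show ?thesis using M Hb[of j] NC by (auto simp: V_def mat_kernel_def)
  qed
  have disj: "V i \<inter> V j = {}" if "i \<in> J" "j \<in> J" "i \<noteq> j" for i j
  proof (rule ccontr)
    assume "V i \<inter> V j \<noteq> {}"
    then obtain x y where xy: "x \<in> N i" "y \<in> N j" "block l H i *\<^sub>v x = block l H j *\<^sub>v y"
      unfolding V_def by blast
    have "i < n" "j < n" using that J by auto
    then have "x = 0\<^sub>v l"
      by (rule sep) (fact that(3) NC(1)[OF xy(1)] NC(1)[OF xy(2)] xy(3))+
    with NC(2)[OF xy(1)] show False ..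
  qed
  have finV: "finite (V j)" for j by (simp add: V_def N_def fin)
  have "(\<Sum>j\<in>J. card (mat_kernel (M * block l H j)) - 1) = (\<Sum>j\<in>J. card (V j))"
  proof (rule sum.cong)
    fix j assume "j \<in> J"
    then have "card (V j) = card (N j)" using inj J by (auto simp: V_def card_image)
    also have "\<dots> = card (mat_kernel (M * block l H j)) - 1"
      using zero_in_mat_kernel[OF mult_carrier_mat[OF M Hb[of j]]] by (simp add: N_def)
    finally show "card (mat_kernel (M * block l H j)) - 1 = card (V j)" by simp
  qed simp
  also have "\<dots> = card (\<Union>j\<in>J. V j)"
    using disj finV finite_subset[OF J] by (intro card_UN_disjoint[symmetric]) auto
  also have "\<dots> \<le> card (mat_kernel M - {0\<^sub>v ?m})"
    using VK J by (intro card_mono) (auto simp: fin)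
  also have "\<dots> = card (mat_kernel M) - 1"
    using zero_in_mat_kernel[OF M] by simp
  finally show ?thesis .
qed

section \<open>Lower bound for the repair bandwidth\<close>

text \<open>Turns a count of nonzero kernel vectors into a linear bound on the dimension, with
  equality for \<open>d \<le> 1\<close>.\<close>

lemma mult_le_power_minus_one:
  fixes q :: nat
  assumes "1 \<le> q"
  shows "(real q - 1) * real d \<le> real q ^ d - 1"
  using Bernoulli_inequality[of "real q - 1" d] assms by (simp add: mult.commute)

lemma sum_rank_lower_bound:
  fixes H :: "'a::{field,finite} mat"
  assumes mds: "mds n k l H" and H: "H \<in> carrier_mat ((n - k) * l) (n * l)"
    and r: "2 \<le> n - k" and i: "i < n" and M: "M \<in> repair_matrices l H i"
  shows "real l * (real n - 1) - (real CARD('a) ^ ((n - k - 1) * l) - 1) / (real CARD('a) - 1)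
    \<le> real (BW n l H i M)"
proof -
  let ?q = "CARD('a)" and ?m = "(n - k) * l" and ?J = "{..<n} - {i}"
  let ?rk = "\<lambda>j. vec_space.rank l (M * block l H j)"
  let ?N = "\<lambda>j. mat_kernel (M * block l H j)"
  have q: "2 \<le> ?q" using card_mono[of UNIV "{0, 1 :: 'a}"] by simp
  have Mc: "M \<in> carrier_mat l ?m" using M H by (auto simp: repair_matrices_def)
  have Hb: "block l H j \<in> carrier_mat ?m l" for j using block_carrier[of l H j] H by simp
  have A: "M * block l H j \<in> carrier_mat l l" for j using Mc Hb by simp
  have rk: "?rk j \<le> l" for j by (rule vec_space.rank_le_nc[OF A])
  obtain Z where Z: "inverts_mat (M * block l H i) Z" "inverts_mat Z (M * block l H i)"
    using M by (auto simp: repair_matrices_def invertible_mat_def)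
  have Zc: "Z \<in> carrier_mat l l"
  proof (rule carrier_matI)
    show "dim_col Z = l"
      using arg_cong[OF Z(1)[unfolded inverts_mat_def], of dim_col] carrier_matD[OF A[of i]] by simp
    show "dim_row Z = l"
      using arg_cong[OF Z(2)[unfolded inverts_mat_def], of dim_col] carrier_matD[OF A[of i]] by simp
  qed
  \<comment> \<open>Repairability of node \<open>i\<close> enters here: the inverse \<open>Z\<close>
    of \<open>M * block l H i\<close> produces a right inverse of \<open>M\<close>.\<close>
  have "M * (block l H i * Z) = 1\<^sub>m l"
    using Z(1) assoc_mult_mat[OF Mc Hb Zc, of i] carrier_matD[OF Mc] by (simp add: inverts_mat_def)
  then have "card (mat_kernel M) * ?q ^ l \<le> ?q ^ ?m"
    using card_kernel_le_right_inverse[OF Mc, of "block l H i * Z"] Hb[of i] Zc by simp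
  \<comment> \<open>Splitting off \<open>l\<close> lets the factor \<open>?q ^ l\<close>
    cancel.\<close>
  also have "?m = (n - k - 1) * l + l"
    using r by (cases "n - k") auto
  finally have K: "card (mat_kernel M) \<le> ?q ^ ((n - k - 1) * l)" by (simp add: power_add)
  \<comment> \<open>The rank deficits \<open>l - ?rk j\<close> are summed with the denominator
    \<open>?q - 1\<close> cleared, so that Bernoulli applies to each node separately.\<close>
  have "(real ?q - 1) * (\<Sum>j\<in>?J. real l - real (?rk j)) = (\<Sum>j\<in>?J. (real ?q - 1) * real (l - ?rk j))"
    using rk by (simp add: sum_distrib_left of_nat_diff)
  also have "\<dots> \<le> (\<Sum>j\<in>?J. real (card (?N j) - 1))"
  proof (rule sum_mono)
    fix j
    have "(real ?q - 1) * real (l - ?rk j) \<le> real ?q ^ (l - ?rk j) - 1"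
      using q by (intro mult_le_power_minus_one) simp
    also have "\<dots> = real (?q ^ (l - ?rk j)) - 1" by simp
    also have "\<dots> \<le> real (card (?N j)) - 1"
      using card_kernel_ge[OF A, of j] by (simp only: of_nat_le_iff diff_right_mono)
    \<comment> \<open>Truncated subtraction on naturals is never below the real difference.\<close>
    also have "\<dots> \<le> real (card (?N j) - 1)" by linarith
    finally show "(real ?q - 1) * real (l - ?rk j) \<le> real (card (?N j) - 1)" .
  qed
  also have "\<dots> \<le> real (card (mat_kernel M) - 1)"
    using sum_kernel_card_le[OF mds H r Mc, of ?J] unfolding of_nat_sum[symmetric] of_nat_le_iff by auto
  also have "\<dots> \<le> real (?q ^ ((n - k - 1) * l) - 1)" using K by (intro of_nat_mono diff_le_mono)
  also have "\<dots> = real ?q ^ ((n - k - 1) * l) - 1" using q by (simp add: of_nat_diff)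
  finally have "(\<Sum>j\<in>?J. real l - real (?rk j)) \<le> (real ?q ^ ((n - k - 1) * l) - 1) / (real ?q - 1)"
    using q by (simp add: pos_le_divide_eq mult.commute)
  moreover have "(\<Sum>j\<in>?J. real l - real (?rk j)) = real l * (real n - 1) - real (BW n l H i M)"
    using i by (simp add: BW_def sum_subtractf of_nat_diff mult.commute)
  ultimately show ?thesis by linarith
qed

section \<open>Passage to minima, averages and maxima\<close>

text \<open>A left inverse of \<open>block l H i\<close> is already a repair matrix. Together with
  finiteness this makes the \<open>Min\<close> in \<open>beta\<close> and \<open>gamma\<close> an
  attained value.\<close>

lemma repair_matrices_nonempty:
  fixes H :: "'a::field mat"
  assumes mds: "mds n k l H" and H: "H \<in> carrier_mat ((n - k) * l) (n * l)"
    and r: "2 \<le> n - k" and i: "i < n"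
  shows "repair_matrices l H i \<noteq> {}"
proof -
  obtain j where j: "j < n" "j \<noteq> i"
      using exists_other_node[OF r, of i] by blast
  obtain X where X: "X \<in> carrier_mat l ((n - k) * l)" "X * block l H i = 1\<^sub>m l"
    using mds_separating_left_inverse[OF mds H i j(1) _ r] j by blast
  have "invertible_mat (1\<^sub>m l :: 'a mat)"
    unfolding invertible_mat_def inverts_mat_def by (intro conjI exI[of _ "1\<^sub>m l"]) auto
  then show ?thesis using X H by (auto simp: repair_matrices_def)
qed

lemma finite_repair_matrices: "finite (repair_matrices l (H :: 'a::{field,finite} mat) i)"
proof -
  let ?d = "dim_row H"
  \<comment> \<open>Encoding a matrix by its rows reduces finiteness to lists of fixed length over a
    finite set.\<close>
  have "repair_matrices l H i \<subseteq> mat_of_rows ?d ` {xs. set xs \<subseteq> carrier_vec ?d \<and> length xs = l}"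
  proof
    fix M assume "M \<in> repair_matrices l H i"
    then have M: "M \<in> carrier_mat l ?d" unfolding repair_matrices_def by blast
    have "mat_of_rows ?d (rows M) = M"
      using mat_of_rows_rows[of M] carrier_matD(2)[OF M] by simp
    moreover have "rows M \<in> {xs. set xs \<subseteq> carrier_vec ?d \<and> length xs = l}"
      using rows_carrier[of M] carrier_matD[OF M] by simp
    ultimately show "M \<in> mat_of_rows ?d ` {xs. set xs \<subseteq> carrier_vec ?d \<and> length xs = l}"
      by (rule rev_image_eqI[OF _ sym, rotated])
  qed
  then show ?thesis
    by (rule finite_subset) (intro finite_imageI finite_lists_length_eq finite_carrier_vec)
qed

lemma average_ge:
  fixes f :: "nat \<Rightarrow> nat"
  assumes "0 < n" and "\<And>i. i < n \<Longrightarrow> b \<le> real (f i)"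
  shows "b \<le> (\<Sum>i<n. real (f i)) / real n"
proof -
  have "real n * b \<le> (\<Sum>i<n. real (f i))"
    using sum_bounded_below[of "{..<n}" b "\<lambda>i. real (f i)"] assms by simp
  then show ?thesis using assms(1) by (simp add: pos_le_divide_eq mult.commute)
qed

lemma Max_image_ge:
  fixes f :: "nat \<Rightarrow> nat"
  assumes "0 < n" and "\<And>i. i < n \<Longrightarrow> b \<le> real (f i)"
  shows "b \<le> real (Max (f ` {..<n}))"
proof -
  \<comment> \<open>As \<open>0 < n\<close>, node 0 exists, and its value already reaches the
    bound.\<close>
  have "f 0 \<le> Max (f ` {..<n})" using assms(1) by (intro Max_ge) auto
  with assms show ?thesis by (meson of_nat_le_iff order_trans)
qed

theorem theorem1p1:
  fixes q n k l r :: nat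
    and C :: "'a::{field, finite} vec set"
    and H :: "'a mat"
    and bound :: real
  assumes "CARD('a) = q"
    and "0 < k" and "k < n" and "0 < l"
    and "r = n - k" and "2 \<le> r"
    and "linear_array_code n k l C"
    and "parity_check n k l C H"
    and "mds n k l H"
    and "bound = real l * (real n - 1) - (real q ^ ((r - 1) * l) - 1) / (real q - 1)"
  shows "beta_avg n l H \<ge> bound
    \<and> real (beta_max n l H) \<ge> bound
    \<and> gamma_avg n l H \<ge> bound
    \<and> real (gamma_max n l H) \<ge> bound"
proof -
  have H: "H \<in> carrier_mat ((n - k) * l) (n * l)" using assms(8) by (simp add: parity_check_def)
  have r: "2 \<le> n - k" and n: "0 < n" using assms by auto
  have BW: "bound \<le> real (BW n l H i M)" if "i < n" "M \<in> repair_matrices l H i" for i M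
    using sum_rank_lower_bound[OF assms(9) H r that] assms by simp
  have IO: "BW n l H i M \<le> IO n l H i M" if "M \<in> repair_matrices l H i" for i M
    unfolding BW_def IO_def using that block_carrier[of l H]
    by (intro sum_mono rank_le_nz) (auto simp: repair_matrices_def)
  \<comment> \<open>The minimum is attained at an actual repair matrix, so a bound valid for every
    \<open>M\<close> passes to \<open>Min\<close>.\<close>
  have min: "bound \<le> real (Min (f ` repair_matrices l H i))"
    if "i < n" "\<And>M. M \<in> repair_matrices l H i \<Longrightarrow> bound \<le> real (f M)" for f i
  proof -
    have "Min (f ` repair_matrices l H i) \<in> f ` repair_matrices l H i"
      using finite_repair_matrices[of l H i] repair_matrices_nonempty[OF assms(9) H r that(1)]
      by (intro Min_in) auto
    with that(2) show ?thesis by auto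
  qed
  have beta: "bound \<le> real (beta n l H i)" if "i < n" for i
    unfolding beta_def by (rule min[OF that BW[OF that]])
  have gamma: "bound \<le> real (gamma n l H i)" if "i < n" for i
    unfolding gamma_def
  proof (rule min[OF that])
    show "bound \<le> real (IO n l H i M)" if "M \<in> repair_matrices l H i" for M
      using BW[OF \<open>i < n\<close> that] IO[OF that] by simp
  qed
  show ?thesis
    unfolding beta_avg_def beta_max_def gamma_avg_def gamma_max_def
    by (intro conjI average_ge[OF n] Max_image_ge[OF n] beta gamma)
qed

end
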